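(* Let $P=\{p,q,r,s\}$ be a set with $4$ elements and let $\tau$ be the involution of $P$ with $(p)\tau=q$, $(q)\tau=p$, $(r)\tau=r$, $(s)\tau=s$. Any non-trivial qualgebra with $4$ elements is isomorphic to the set $P$ with operations $\lhd,\diamond$ of the following form (here $x,y$ are arbitrary elements of $P$): \begin{align*} & x\lhd r=(x)\tau, && x\lhd y=x \ \text{ if } y\neq r,\\ & r\diamond r=s, && r\diamond x=x\diamond r=r\ \text{ if } x\neq r,\\ & s\diamond s=s, && q\diamond s=s\diamond q\in\{p,q,s\},\quad p\diamond s=s\diamond p=(q\diamond s)\tau,\\ & p\diamond q=q\diamond p=s, && q\diamond q\in\{p,q,s\},\quad p\diamond p=(q\diamond q)\tau. \end{align*} Moreover, for any choices of $q\diamond s$ and $q\diamond q$ in $\{p,q,s\}$, the resulting structure is a qualgebra.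
   Context: A qualgebra is a set $Q$ with two binary operations $\lhd,\diamond$ for which there is a (necessarily unique) binary operation $\widetilde{\lhd}$ on $Q$ such that for all $a,b,c\in Q$: $(a\lhd b)\lhd c=(a\lhd c)\lhd(b\lhd c)$; $(a\lhd b)\,\widetilde{\lhd}\, b=(a\,\widetilde{\lhd}\, b)\lhd b=a$; $a\lhd a=a$; $a\lhd(b\diamond c)=(a\lhd b)\lhd c$; $(a\diamond b)\lhd c=(a\lhd c)\diamond(b\lhd c)$; $a\diamond b=b\diamond(a\lhd b)$. A qualgebra is trivial if $a\lhd b=a$ for all $a,b$. An isomorphism of qualgebras is a bijection respecting $\lhd$ and $\diamond$. *)

theory Defs
  imports Main
begin

text \<open>
  Qualgebras are given by a carrier set and two binary operations, whose values matter only
  on the carrier. The maps \<open>lhd\<close> and \<open>dia\<close> stand for the two operations, and \<open>lhd' a b\<close> in the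
  axiom \<open>lhd_inverse\<close> is the inverse operation (written with a tilde on paper), which is part
  of the axioms but not of the structure since it is uniquely determined on the carrier.
\<close>

locale qualgebra =
  fixes Q :: "'a set"
    and lhd :: "'a \<Rightarrow> 'a \<Rightarrow> 'a" (infixl "\<lhd>\<^sub>Q" 70)
    and dia :: "'a \<Rightarrow> 'a \<Rightarrow> 'a" (infixl "\<diamondop>\<^sub>Q" 70)
  assumes lhd_closed: "\<lbrakk>a \<in> Q; b \<in> Q\<rbrakk> \<Longrightarrow> a \<lhd>\<^sub>Q b \<in> Q"
    and dia_closed: "\<lbrakk>a \<in> Q; b \<in> Q\<rbrakk> \<Longrightarrow> a \<diamondop>\<^sub>Q b \<in> Q"
    and self_distrib: "\<lbrakk>a \<in> Q; b \<in> Q; c \<in> Q\<rbrakk> \<Longrightarrow>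
          (a \<lhd>\<^sub>Q b) \<lhd>\<^sub>Q c = (a \<lhd>\<^sub>Q c) \<lhd>\<^sub>Q (b \<lhd>\<^sub>Q c)"
    and lhd_inverse: "\<exists>lhd'. \<forall>a\<in>Q. \<forall>b\<in>Q. lhd' a b \<in> Q \<and>
          lhd' (a \<lhd>\<^sub>Q b) b = a \<and> (lhd' a b) \<lhd>\<^sub>Q b = a"
    and lhd_idem: "a \<in> Q \<Longrightarrow> a \<lhd>\<^sub>Q a = a"
    and lhd_dia: "\<lbrakk>a \<in> Q; b \<in> Q; c \<in> Q\<rbrakk> \<Longrightarrow>
          a \<lhd>\<^sub>Q (b \<diamondop>\<^sub>Q c) = (a \<lhd>\<^sub>Q b) \<lhd>\<^sub>Q c"
    and dia_lhd: "\<lbrakk>a \<in> Q; b \<in> Q; c \<in> Q\<rbrakk> \<Longrightarrow>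
          (a \<diamondop>\<^sub>Q b) \<lhd>\<^sub>Q c = (a \<lhd>\<^sub>Q c) \<diamondop>\<^sub>Q (b \<lhd>\<^sub>Q c)"
    and dia_semicomm: "\<lbrakk>a \<in> Q; b \<in> Q\<rbrakk> \<Longrightarrow> a \<diamondop>\<^sub>Q b = b \<diamondop>\<^sub>Q (a \<lhd>\<^sub>Q b)"

definition trivial_qualgebra :: "'a set \<Rightarrow> ('a \<Rightarrow> 'a \<Rightarrow> 'a) \<Rightarrow> bool" where
  "trivial_qualgebra Q lhd \<longleftrightarrow> (\<forall>a\<in>Q. \<forall>b\<in>Q. lhd a b = a)"

definition qualgebra_iso ::
    "('a \<Rightarrow> 'b) \<Rightarrow> 'a set \<Rightarrow> ('a \<Rightarrow> 'a \<Rightarrow> 'a) \<Rightarrow> ('a \<Rightarrow> 'a \<Rightarrow> 'a) \<Rightarrow>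
     'b set \<Rightarrow> ('b \<Rightarrow> 'b \<Rightarrow> 'b) \<Rightarrow> ('b \<Rightarrow> 'b \<Rightarrow> 'b) \<Rightarrow> bool" where
  "qualgebra_iso f Q lhd dia Q' lhd' dia' \<longleftrightarrow>
     bij_betw f Q Q' \<and>
     (\<forall>a\<in>Q. \<forall>b\<in>Q. f (lhd a b) = lhd' (f a) (f b)) \<and>
     (\<forall>a\<in>Q. \<forall>b\<in>Q. f (dia a b) = dia' (f a) (f b))"

text \<open>
  The two operations on \<open>{p, q, r, s}\<close> belonging to the choices \<open>q \<diamondop> s = u\<close> and \<open>q \<diamondop> q = v\<close>;
  the clauses determine both operations on all of \<open>{p, q, r, s}\<close>.
\<close>

definition four_table ::
    "'b \<Rightarrow> 'b \<Rightarrow> 'b \<Rightarrow> 'b \<Rightarrow> ('b \<Rightarrow> 'b) \<Rightarrow> 'b \<Rightarrow> 'b \<Rightarrow>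
     ('b \<Rightarrow> 'b \<Rightarrow> 'b) \<Rightarrow> ('b \<Rightarrow> 'b \<Rightarrow> 'b) \<Rightarrow> bool" where
  "four_table p q r s \<tau> u v lhd dia \<longleftrightarrow>
     (\<forall>x\<in>{p, q, r, s}. lhd x r = \<tau> x) \<and>
     (\<forall>x\<in>{p, q, r, s}. \<forall>y\<in>{p, q, r, s}. y \<noteq> r \<longrightarrow> lhd x y = x) \<and>
     dia r r = s \<and>
     (\<forall>x\<in>{p, q, r, s}. x \<noteq> r \<longrightarrow> dia r x = r \<and> dia x r = r) \<and>
     dia s s = s \<and>
     dia q s = u \<and> dia s q = u \<and>
     dia p s = \<tau> (dia q s) \<and> dia s p = \<tau> (dia q s) \<and>
     dia p q = s \<and> dia q p = s \<and>
     dia q q = v \<and> dia p p = \<tau> (dia q q)"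

end

theory Submission
  imports Defs
begin

text \<open>
  Write \<open>\<sigma>\<^sub>b\<close> for the translation \<open>x \<mapsto> x \<lhd> b\<close>. By the axioms \<open>\<sigma>\<^sub>b\<close> is an automorphism fixing \<open>b\<close>,
  and \<open>\<sigma>\<close> of \<open>b \<diamondop> c\<close> is \<open>\<sigma>\<^sub>b\<close> followed by \<open>\<sigma>\<^sub>c\<close>, so the translations are closed under composition.

  The key point is that, unless \<open>b\<close> is the only element, \<open>\<sigma>\<^sub>b\<close> fixes a point other than \<open>b\<close>
  (\<open>second_fixed_point\<close>): the
  element \<open>b \<diamondop> b\<close> is fixed, and if it equals \<open>b\<close>, then \<open>\<sigma>\<^sub>b\<close> is idempotent, hence the identity.
  On four points, a non-identity translation is therefore a transposition. A product of two
  different transpositions has at most one fixed point, so it cannot be a translation; hence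
  there is exactly one non-identity translation \<open>(p q)\<close> (\<open>nontrivial_translations_agree\<close>). The
  elements inducing it are among its fixed points \<open>r\<close>, \<open>s\<close>, and not both induce it: \<open>r \<diamondop> r\<close> is
  a fixed point that induces the identity. With \<open>r\<close> the only element inducing \<open>(p q)\<close>,
  each prescribed product is found by asking which translation it induces and whether \<open>(p q)\<close>
  fixes it; nothing restricts \<open>q \<diamondop> s\<close> and \<open>q \<diamondop> q\<close> beyond their inducing the identity
  (\<open>four_table_of_nontrivial\<close>).

  Conversely, in each such table \<open>\<sigma>\<^sub>r\<close> is an involutive automorphism and \<open>\<diamondop>\<close> maps to
  composition of translations, which is a finite verification (\<open>qualgebra_of_four_table\<close>).
\<close>

section \<open>Translations in a qualgebra\<close>

context qualgebra
begin

lemma lhd_right_cancel: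
  assumes "a \<in> Q" "b \<in> Q" "c \<in> Q"
  shows "a \<lhd>\<^sub>Q c = b \<lhd>\<^sub>Q c \<longleftrightarrow> a = b"
  using lhd_inverse assms by metis

lemma second_fixed_point:
  assumes b: "b \<in> Q" and a: "a \<in> Q" "a \<noteq> b"
  obtains s where "s \<in> Q" "s \<noteq> b" "s \<lhd>\<^sub>Q b = s"
proof (cases "b \<diamondop>\<^sub>Q b = b")
  case True
  \<comment> \<open>Here \<open>\<sigma>\<^sub>b\<close> is an injective idempotent map, so that every point is fixed.\<close>
  have "(a \<lhd>\<^sub>Q b) \<lhd>\<^sub>Q b = a \<lhd>\<^sub>Q b"
    using lhd_dia[OF a(1) b b] True by simp
  then have "a \<lhd>\<^sub>Q b = a"
    using lhd_right_cancel a b lhd_closed by blast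
  with a that show ?thesis by blast
next
  case False
  have "(b \<diamondop>\<^sub>Q b) \<lhd>\<^sub>Q b = b \<diamondop>\<^sub>Q b"
    using dia_lhd[OF b b b] lhd_idem[OF b] by simp
  with False b dia_closed that show ?thesis by blast
qed

end

section \<open>The unique non-identity translation on four points\<close>

lemma card_4_eqI:
  assumes "card Q = 4" "{p, q, r, s} \<subseteq> Q" "distinct [p, q, r, s]"
  shows "Q = {p, q, r, s}"
proof -
  have "finite Q" using assms(1) card.infinite by fastforce
  moreover have "card {p, q, r, s} = 4" using assms(3) by simp
  ultimately show ?thesis using assms(1,2) card_subset_eq by metis
qed

lemma distinct_of_card_4:
  assumes "card {p, q, r, s} = 4"
  shows "distinct [p, q, r, s]"
  using assms by (intro card_distinct) simp

locale qualgebra_4 = qualgebra +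
  assumes card_Q: "card Q = 4"
begin

text \<open>Two points are fixed, so the other two, one of which is moved, are exchanged.\<close>

lemma nontrivial_translation_transposition:
  assumes a: "a \<in> Q" and b: "b \<in> Q" and moved: "a \<lhd>\<^sub>Q b \<noteq> a"
  obtains s where "Q = {a, a \<lhd>\<^sub>Q b, b, s}" "distinct [a, a \<lhd>\<^sub>Q b, b, s]"
    "(a \<lhd>\<^sub>Q b) \<lhd>\<^sub>Q b = a" "b \<lhd>\<^sub>Q b = b" "s \<lhd>\<^sub>Q b = s"
proof -
  have "a \<noteq> b" using moved lhd_idem b by auto
  then obtain s where s: "s \<in> Q" "s \<noteq> b" "s \<lhd>\<^sub>Q b = s"
    using second_fixed_point[OF b a] by blast
  define q where "q = a \<lhd>\<^sub>Q b"
  have q: "q \<in> Q" using a b lhd_closed q_def by simp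
  have bb: "b \<lhd>\<^sub>Q b = b" using b lhd_idem by simp
  have "q \<noteq> b" "q \<noteq> s"
    unfolding q_def using lhd_right_cancel[of a b b] lhd_right_cancel[of a s b]
      a b s bb moved by auto
  then have dist: "distinct [a, q, b, s]"
    using moved s bb by (auto simp: q_def)
  have Q: "Q = {a, q, b, s}"
    using card_4_eqI[OF card_Q _ dist] a b s q by simp
  have "q \<lhd>\<^sub>Q b \<in> {a, q, b, s}" using lhd_closed q b Q by simp
  moreover have "q \<lhd>\<^sub>Q b \<noteq> q" "q \<lhd>\<^sub>Q b \<noteq> b" "q \<lhd>\<^sub>Q b \<noteq> s"
    using lhd_right_cancel[of q a b] lhd_right_cancel[of q b b] lhd_right_cancel[of q s b]
      a b q s bb dist by (auto simp: q_def)
  ultimately have "q \<lhd>\<^sub>Q b = a" by auto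
  with Q dist bb s show ?thesis unfolding q_def by (intro that)
qed

lemma translation_involutive:
  assumes "x \<in> Q" "b \<in> Q"
  shows "(x \<lhd>\<^sub>Q b) \<lhd>\<^sub>Q b = x"
proof (cases "x \<lhd>\<^sub>Q b = x")
  case False
  then show ?thesis
    using nontrivial_translation_transposition[OF assms False] by blast
qed simp

text \<open>A transposition is determined by its value at one point that it moves.\<close>

lemma nontrivial_translation_eqI:
  assumes "x \<in> Q" "b \<in> Q" "c \<in> Q" "x \<lhd>\<^sub>Q b \<noteq> x" "x \<lhd>\<^sub>Q c = x \<lhd>\<^sub>Q b" "y \<in> Q"
  shows "y \<lhd>\<^sub>Q c = y \<lhd>\<^sub>Q b"
proof -
  obtain s where s: "Q = {x, x \<lhd>\<^sub>Q b, b, s}" "distinct [x, x \<lhd>\<^sub>Q b, b, s]"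
    "(x \<lhd>\<^sub>Q b) \<lhd>\<^sub>Q b = x" "b \<lhd>\<^sub>Q b = b" "s \<lhd>\<^sub>Q b = s"
    using nontrivial_translation_transposition assms by metis
  obtain t where t: "Q = {x, x \<lhd>\<^sub>Q c, c, t}" "distinct [x, x \<lhd>\<^sub>Q c, c, t]"
    "(x \<lhd>\<^sub>Q c) \<lhd>\<^sub>Q c = x" "c \<lhd>\<^sub>Q c = c" "t \<lhd>\<^sub>Q c = t"
    using nontrivial_translation_transposition[of x c] assms by metis
  have "y \<lhd>\<^sub>Q b = (if y = x then x \<lhd>\<^sub>Q b else if y = x \<lhd>\<^sub>Q b then x else y)"
    using s assms(6) by auto
  moreover have "y \<lhd>\<^sub>Q c = (if y = x then x \<lhd>\<^sub>Q c else if y = x \<lhd>\<^sub>Q c then x else y)"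
    using t assms(6) by auto
  ultimately show ?thesis using assms(5) by simp
qed

text \<open>
  A point fixed by the product of two involutions is one on which they agree. The product of
  \<open>\<sigma>\<^sub>b\<close> and \<open>\<sigma>\<^sub>c\<close> is again a translation, so these transpositions agree on two points. If one of
  the two points is moved, the transpositions coincide; otherwise both exchange the remaining
  two points.
\<close>

lemma nontrivial_translations_agree:
  assumes a: "a \<in> Q" and b: "b \<in> Q" and ab: "a \<lhd>\<^sub>Q b \<noteq> a"
    and e: "e \<in> Q" and c: "c \<in> Q" and ec: "e \<lhd>\<^sub>Q c \<noteq> e"
    and x: "x \<in> Q"
  shows "x \<lhd>\<^sub>Q c = x \<lhd>\<^sub>Q b"
proof -
  define d where "d = b \<diamondop>\<^sub>Q c"
  have d: "d \<in> Q" using b c dia_closed d_def by simp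
  obtain d0 where "d0 \<in> Q" "d0 \<noteq> d"
    using a ab lhd_closed[OF a b] by metis
  then obtain d' where d': "d' \<in> Q" "d' \<noteq> d" "d' \<lhd>\<^sub>Q d = d'"
    using second_fixed_point[OF d] by blast
  have agree: "y \<lhd>\<^sub>Q c = y \<lhd>\<^sub>Q b" if y: "y \<in> Q" and fixed: "y \<lhd>\<^sub>Q d = y" for y
  proof -
    have "(y \<lhd>\<^sub>Q b) \<lhd>\<^sub>Q c = y"
      using lhd_dia[OF y b c] fixed unfolding d_def by simp
    then show ?thesis
      using translation_involutive[OF lhd_closed[OF y b] c] by simp
  qed
  have agd: "d \<lhd>\<^sub>Q c = d \<lhd>\<^sub>Q b" and agd': "d' \<lhd>\<^sub>Q c = d' \<lhd>\<^sub>Q b"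
    using agree[OF d lhd_idem[OF d]] agree[OF d'(1,3)] .
  consider "d \<lhd>\<^sub>Q b \<noteq> d" | "d' \<lhd>\<^sub>Q b \<noteq> d'" | "d \<lhd>\<^sub>Q b = d" "d' \<lhd>\<^sub>Q b = d'" by blast
  then show ?thesis
  proof cases
    case 1
    then show ?thesis using nontrivial_translation_eqI[OF d b c _ agd x] by simp
  next
    case 2
    then show ?thesis using nontrivial_translation_eqI[OF d'(1) b c _ agd' x] by simp
  next
    case 3
    obtain s where Q: "Q = {a, a \<lhd>\<^sub>Q b, b, s}" and ab_back: "(a \<lhd>\<^sub>Q b) \<lhd>\<^sub>Q b = a"
      by (rule nontrivial_translation_transposition[OF a b ab])
    have fixed_by_b: "y = b \<or> y = s" if "y \<in> Q" "y \<lhd>\<^sub>Q b = y" for y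
    proof -
      have "y \<noteq> a" "y \<noteq> a \<lhd>\<^sub>Q b" using that(2) ab ab_back by metis+
      with that(1) show ?thesis unfolding Q by blast
    qed
    then have "b = d \<and> s = d' \<or> b = d' \<and> s = d"
      using fixed_by_b[OF d 3(1)] fixed_by_b[OF d'(1) 3(2)] d'(2) by blast
    then have fixed: "b \<lhd>\<^sub>Q c = b" "s \<lhd>\<^sub>Q c = s"
      using agd agd' 3 by auto
    have ec_back: "(e \<lhd>\<^sub>Q c) \<lhd>\<^sub>Q c = e" using translation_involutive e c by simp
    have "e \<noteq> b" "e \<noteq> s" using fixed ec by auto
    then have e': "e = a \<or> e = a \<lhd>\<^sub>Q b" using e unfolding Q by blast
    have "e \<lhd>\<^sub>Q c \<noteq> b" "e \<lhd>\<^sub>Q c \<noteq> s" using fixed ec ec_back by metis+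
    then have ec': "e \<lhd>\<^sub>Q c = a \<or> e \<lhd>\<^sub>Q c = a \<lhd>\<^sub>Q b"
      using lhd_closed[OF e c] unfolding Q by blast
    from e' have "e \<lhd>\<^sub>Q b \<noteq> e \<and> e \<lhd>\<^sub>Q c = e \<lhd>\<^sub>Q b"
    proof
      assume "e = a"
      with ec ec' ab show ?thesis by simp
    next
      assume e_eq: "e = a \<lhd>\<^sub>Q b"
      with ec ec' have "e \<lhd>\<^sub>Q c = a" by simp
      with e_eq ab_back ab show ?thesis by simp
    qed
    then show ?thesis
      using nontrivial_translation_eqI[OF e b c _ _ x] by simp
  qed
qed

section \<open>The multiplication table\<close>

text \<open>
  An element inducing the identity is not \<open>r\<close>, and a point fixed by \<open>\<sigma>\<^sub>r\<close> is \<open>r\<close> or \<open>s\<close>; this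
  pins down the products below. For example, \<open>p \<diamondop> q = q \<diamondop> p\<close> as \<open>q\<close> induces the identity, so this
  product is fixed by \<open>\<sigma>\<^sub>r\<close> and induces the identity, which leaves only \<open>s\<close>.
\<close>

lemma four_table_of_nontrivial:
  assumes nontriv: "\<not> trivial_qualgebra Q (\<lhd>\<^sub>Q)"
  obtains p q r s where "Q = {p, q, r, s}" "distinct [p, q, r, s]"
    "p \<lhd>\<^sub>Q r = q" "q \<lhd>\<^sub>Q r = p" "r \<lhd>\<^sub>Q r = r" "s \<lhd>\<^sub>Q r = s"
    "q \<diamondop>\<^sub>Q s \<in> {p, q, s}" "q \<diamondop>\<^sub>Q q \<in> {p, q, s}"
    "four_table p q r s (\<lambda>x. x \<lhd>\<^sub>Q r) (q \<diamondop>\<^sub>Q s) (q \<diamondop>\<^sub>Q q) (\<lhd>\<^sub>Q) (\<diamondop>\<^sub>Q)"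
proof -
  obtain p r where p: "p \<in> Q" and r: "r \<in> Q" and moved: "p \<lhd>\<^sub>Q r \<noteq> p"
    using nontriv unfolding trivial_qualgebra_def by auto
  define q where "q = p \<lhd>\<^sub>Q r"
  obtain s where Q: "Q = {p, q, r, s}" and dist: "distinct [p, q, r, s]"
    and qr: "q \<lhd>\<^sub>Q r = p" and rr: "r \<lhd>\<^sub>Q r = r" and sr: "s \<lhd>\<^sub>Q r = s"
    using nontrivial_translation_transposition[OF p r moved] unfolding q_def by metis
  have pr: "p \<lhd>\<^sub>Q r = q" by (simp add: q_def)
  have q: "q \<in> Q" and s: "s \<in> Q" using Q by auto
  have dichotomy: "(\<forall>x\<in>Q. x \<lhd>\<^sub>Q c = x) \<or> (\<forall>x\<in>Q. x \<lhd>\<^sub>Q c = x \<lhd>\<^sub>Q r)" if "c \<in> Q" for c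
    using nontrivial_translations_agree[OF p r moved _ that] by blast
  have trp: "x \<lhd>\<^sub>Q p = x" if "x \<in> Q" for x
    using dichotomy[OF p] lhd_idem[OF p] moved p that by force
  have trq: "x \<lhd>\<^sub>Q q = x" if "x \<in> Q" for x
    using dichotomy[OF q] lhd_idem[OF q] qr dist q that by force
  \<comment> \<open>The element \<open>r \<diamondop> r\<close> is fixed by \<open>\<sigma>\<^sub>r\<close> and induces its square, the identity. It is therefore
    \<open>s\<close>, which shows in particular that \<open>s\<close> does not induce the transposition.\<close>
  have rr_fixed: "(r \<diamondop>\<^sub>Q r) \<lhd>\<^sub>Q r = r \<diamondop>\<^sub>Q r" using dia_lhd[OF r r r] rr by simp
  have rr_Q: "r \<diamondop>\<^sub>Q r \<in> Q" using r dia_closed by simp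
  have rr_id: "x \<lhd>\<^sub>Q (r \<diamondop>\<^sub>Q r) = x" if "x \<in> Q" for x
    using that lhd_dia r translation_involutive by simp
  have eq_s: "y = s" if "y \<in> Q" "y \<lhd>\<^sub>Q r = y" "p \<lhd>\<^sub>Q y = p" for y
    using that Q dist pr qr moved by auto
  have rrs: "r \<diamondop>\<^sub>Q r = s"
    using eq_s[OF rr_Q rr_fixed rr_id[OF p]] .
  have trs: "x \<lhd>\<^sub>Q s = x" if "x \<in> Q" for x
    using rr_id[OF that] rrs by simp
  have eq_r: "y = r" if "y \<in> Q" "p \<lhd>\<^sub>Q y \<noteq> p" for y
    using that Q trp[OF p] trq[OF p] trs[OF p] by auto
  have id: "x \<lhd>\<^sub>Q y = x" if "x \<in> Q" "y \<in> Q" "y \<noteq> r" for x y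
    using that trp trq trs Q by auto
  have r_absorbs: "r \<diamondop>\<^sub>Q x = r \<and> x \<diamondop>\<^sub>Q r = r" if "x \<in> Q" "x \<noteq> r" for x
  proof
    show "r \<diamondop>\<^sub>Q x = r"
      using that lhd_dia[OF p r] id p q moved pr dist r trs dia_closed
      by (intro eq_r) auto
    show "x \<diamondop>\<^sub>Q r = r"
      using that lhd_dia[OF p _ r] id p q moved pr dist r trs dia_closed
      by (intro eq_r) auto
  qed
  have comm: "x \<diamondop>\<^sub>Q y = y \<diamondop>\<^sub>Q x" if "x \<in> Q" "y \<in> Q" "y \<noteq> r" for x y
    using dia_semicomm id that by metis
  have not_r: "x \<diamondop>\<^sub>Q y \<in> {p, q, s}" if "x \<in> Q" "y \<in> Q" "x \<noteq> r" "y \<noteq> r" for x y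
  proof -
    have "p \<lhd>\<^sub>Q (x \<diamondop>\<^sub>Q y) = p"
      using lhd_dia[OF p that(1,2)] id p that by simp
    with moved have "x \<diamondop>\<^sub>Q y \<noteq> r" by metis
    with dia_closed[OF that(1,2)] show ?thesis unfolding Q by blast
  qed
  have ss: "s \<diamondop>\<^sub>Q s = s"
    using s r p sr dia_lhd[of s s r] lhd_dia[of p s s] trs dia_closed by (intro eq_s) auto
  have pq: "p \<diamondop>\<^sub>Q q = s"
    using p q r pr qr dia_lhd[of p q r] lhd_dia[of p p q] trp trq dia_closed comm[of p q] dist
    by (intro eq_s) auto
  have "four_table p q r s (\<lambda>x. x \<lhd>\<^sub>Q r) (q \<diamondop>\<^sub>Q s) (q \<diamondop>\<^sub>Q q) (\<lhd>\<^sub>Q) (\<diamondop>\<^sub>Q)"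
    unfolding four_table_def Q[symmetric]
    using id rrs r_absorbs ss pq comm[of p q] comm[of q s] comm[of p s] p q s dist
      dia_lhd[OF q s r] dia_lhd[OF q q r] qr sr by auto
  with Q dist pr qr rr sr not_r[OF q s] not_r[OF q q] show ?thesis
    by (intro that) auto
qed

end

lemma four_table_values:
  assumes tab: "four_table p q r s \<tau> u v lhd dia"
    and dist: "distinct [p, q, r, s]"
    and tau: "\<tau> p = q" "\<tau> q = p" "\<tau> r = r" "\<tau> s = s"
  shows "lhd p p = p" "lhd p q = p" "lhd p r = q" "lhd p s = p"
    "lhd q p = q" "lhd q q = q" "lhd q r = p" "lhd q s = q"
    "lhd r p = r" "lhd r q = r" "lhd r r = r" "lhd r s = r"
    "lhd s p = s" "lhd s q = s" "lhd s r = s" "lhd s s = s"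
    "dia p p = \<tau> v" "dia p q = s" "dia p r = r" "dia p s = \<tau> u"
    "dia q p = s" "dia q q = v" "dia q r = r" "dia q s = u"
    "dia r p = r" "dia r q = r" "dia r r = s" "dia r s = r"
    "dia s p = \<tau> u" "dia s q = u" "dia s r = r" "dia s s = s"
  \<comment> \<open>Reversing the list supplies the inequalities in both orientations.\<close>
  using dist dist[THEN distinct_rev[THEN iffD2]]
  by (simp_all add: tab[unfolded four_table_def] tau)

text \<open>
  The operations are conjugated by the relabelling \<open>f\<close>. The entries that are given through the
  involution keep this form because \<open>f\<close> intertwines the two involutions.
\<close>

lemma four_table_transport:
  fixes p q r s :: 'a and p' q' r' s' :: 'b
  assumes tab: "four_table p q r s \<tau> u v lhd dia"
    and dist: "distinct [p, q, r, s]" and dist': "distinct [p', q', r', s']"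
    and tau: "\<tau> p = q" "\<tau> q = p" "\<tau> r = r" "\<tau> s = s"
    and tau': "\<tau>' p' = q'" "\<tau>' q' = p'" "\<tau>' r' = r'" "\<tau>' s' = s'"
    and uv: "u \<in> {p, q, s}" "v \<in> {p, q, s}"
  obtains u' v' lhd' dia' f where "u' \<in> {p', q', s'}" "v' \<in> {p', q', s'}"
    "four_table p' q' r' s' \<tau>' u' v' lhd' dia'"
    "qualgebra_iso f {p, q, r, s} lhd dia {p', q', r', s'} lhd' dia'"
proof -
  note val = four_table_values[OF tab dist tau]
  define f where "f = (\<lambda>x. if x = p then p' else if x = q then q' else if x = r then r' else s')"
  define g where "g = (\<lambda>x. if x = p' then p else if x = q' then q else if x = r' then r else s)"
  have f: "f p = p'" "f q = q'" "f r = r'" "f s = s'"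
    and g: "g p' = p" "g q' = q" "g r' = r" "g s' = s"
    using dist dist' by (auto simp: f_def g_def)
  define lhd' where "lhd' = (\<lambda>x y. f (lhd (g x) (g y)))"
  define dia' where "dia' = (\<lambda>x y. f (dia (g x) (g y)))"
  have f_tau: "f (\<tau> w) = \<tau>' (f w)" if "w \<in> {p, q, s}" for w
    using that by (auto simp: f tau tau')
  have "four_table p' q' r' s' \<tau>' (f u) (f v) lhd' dia'"
    unfolding four_table_def lhd'_def dia'_def
    using dist' by (simp add: f g val tau' f_tau uv[simplified])
  moreover have "bij_betw f {p, q, r, s} {p', q', r', s'}"
    by (intro bij_betw_byWitness[where f' = g]) (auto simp: f g)
  then have "qualgebra_iso f {p, q, r, s} lhd dia {p', q', r', s'} lhd' dia'"
    unfolding qualgebra_iso_def lhd'_def dia'_def by (simp add: f g)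
  moreover have "f u \<in> {p', q', s'}" "f v \<in> {p', q', s'}"
    using uv by (auto simp: f)
  ultimately show ?thesis using that by blast
qed

section \<open>Every table is realized\<close>

lemma four_table_exists:
  assumes "distinct [p, q, r, s]"
  shows "\<exists>lhd dia. four_table p q r s \<tau> u v lhd dia"
proof -
  define dia where "dia = (\<lambda>x y.
    if x = r then (if y = r then s else r) else if y = r then r
    else if x = s \<and> y = s then s
    else if x = q \<and> y = s \<or> x = s \<and> y = q then u
    else if x = p \<and> y = s \<or> x = s \<and> y = p then \<tau> u
    else if x = q \<and> y = q then v
    else if x = p \<and> y = p then \<tau> v else s)"
  have "four_table p q r s \<tau> u v (\<lambda>x y. if y = r then \<tau> x else x) dia"
    unfolding four_table_def dia_def using assms by auto
  then show ?thesis by blast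
qed

text \<open>
  Each translation is an involution, so \<open>\<lhd>\<close> serves as its own inverse operation. The values \<open>u\<close>
  and \<open>v\<close> are arbitrary because \<open>p\<close>, \<open>q\<close>, \<open>s\<close> all induce the identity, and the entries \<open>\<tau> u\<close>
  and \<open>\<tau> v\<close> are what makes \<open>\<tau>\<close> an automorphism for \<open>\<diamondop>\<close>.
\<close>

lemma qualgebra_of_four_table:
  assumes tab: "four_table p q r s \<tau> u v lhd dia"
    and dist: "distinct [p, q, r, s]"
    and tau: "\<tau> p = q" "\<tau> q = p" "\<tau> r = r" "\<tau> s = s"
    and uv: "u \<in> {p, q, s}" "v \<in> {p, q, s}"
  shows "qualgebra {p, q, r, s} lhd dia"
proof -
  note val = four_table_values[OF tab dist tau]
  show ?thesis
  proof
    show "\<exists>lhd'. \<forall>a\<in>{p, q, r, s}. \<forall>b\<in>{p, q, r, s}. lhd' a b \<in> {p, q, r, s} \<and>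
        lhd' (lhd a b) b = a \<and> lhd (lhd' a b) b = a"
      by (rule exI[of _ lhd]) (simp add: val)
  next
    fix a b assume "a \<in> {p, q, r, s}" "b \<in> {p, q, r, s}"
    then show "dia a b \<in> {p, q, r, s}"
      using uv by (elim insertE emptyE) (simp_all add: val tau)
  next
    fix a b c assume "a \<in> {p, q, r, s}" "b \<in> {p, q, r, s}" "c \<in> {p, q, r, s}"
    then show "lhd a (dia b c) = lhd (lhd a b) c"
      using uv by (elim insertE emptyE) (simp_all add: val tau)
  next
    fix a b c assume "a \<in> {p, q, r, s}" "b \<in> {p, q, r, s}" "c \<in> {p, q, r, s}"
    then show "lhd (dia a b) c = dia (lhd a c) (lhd b c)"
      using uv by (elim insertE emptyE) (simp_all add: val tau)
  qed (auto simp: val)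
qed

theorem proposition5p10:
  fixes p q r s :: 'b and P :: "'b set" and \<tau> :: "'b \<Rightarrow> 'b"
  assumes "P = {p, q, r, s}" and "card P = 4"
    and "\<tau> p = q" and "\<tau> q = p" and "\<tau> r = r" and "\<tau> s = s"
  shows "(\<forall>(Q :: 'a set) lhd dia.
            qualgebra Q lhd dia \<and> card Q = 4 \<and> \<not> trivial_qualgebra Q lhd \<longrightarrow>
            (\<exists>u\<in>{p, q, s}. \<exists>v\<in>{p, q, s}. \<exists>lhd' dia' f.
               four_table p q r s \<tau> u v lhd' dia' \<and>
               qualgebra_iso f Q lhd dia P lhd' dia')) \<and>
         (\<forall>u\<in>{p, q, s}. \<forall>v\<in>{p, q, s}.
            (\<exists>lhd dia. four_table p q r s \<tau> u v lhd dia) \<and>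
            (\<forall>lhd dia. four_table p q r s \<tau> u v lhd dia \<longrightarrow> qualgebra P lhd dia))"
proof (intro conjI allI impI ballI)
  have dist: "distinct [p, q, r, s]"
    using assms(1,2) distinct_of_card_4 by simp
  {
    fix Q :: "'a set" and lhd dia
    assume "qualgebra Q lhd dia \<and> card Q = 4 \<and> \<not> trivial_qualgebra Q lhd"
    then have nontriv: "\<not> trivial_qualgebra Q lhd" and "qualgebra_4 Q lhd dia"
      by (auto simp: qualgebra_4_def qualgebra_4_axioms_def)
    then interpret qualgebra_4 Q lhd dia by simp
    obtain p0 q0 r0 s0 where Q: "Q = {p0, q0, r0, s0}" and dist0: "distinct [p0, q0, r0, s0]"
      and tau0: "lhd p0 r0 = q0" "lhd q0 r0 = p0" "lhd r0 r0 = r0" "lhd s0 r0 = s0"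
      and uv0: "dia q0 s0 \<in> {p0, q0, s0}" "dia q0 q0 \<in> {p0, q0, s0}"
      and tab: "four_table p0 q0 r0 s0 (\<lambda>x. lhd x r0) (dia q0 s0) (dia q0 q0) lhd dia"
      by (rule four_table_of_nontrivial[OF nontriv])
    obtain u v lhd' dia' f where "u \<in> {p, q, s}" "v \<in> {p, q, s}"
      "four_table p q r s \<tau> u v lhd' dia'" "qualgebra_iso f Q lhd dia P lhd' dia'"
      using four_table_transport[OF tab dist0 dist tau0 assms(3-6) uv0]
      unfolding Q[symmetric] assms(1)[symmetric] .
    then show "\<exists>u\<in>{p, q, s}. \<exists>v\<in>{p, q, s}. \<exists>lhd' dia' f.
        four_table p q r s \<tau> u v lhd' dia' \<and> qualgebra_iso f Q lhd dia P lhd' dia'"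
      by blast
  next
    fix u v
    show "\<exists>lhd dia. four_table p q r s \<tau> u v lhd dia"
      using four_table_exists[OF dist] .
  next
    fix u v lhd dia
    assume "u \<in> {p, q, s}" "v \<in> {p, q, s}" "four_table p q r s \<tau> u v lhd dia"
    then show "qualgebra P lhd dia"
      using qualgebra_of_four_table dist assms by metis
  }
qed

end
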